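(* Let $\mathcal{F}$ be the class of the probability measures on the interval $I \subseteq \mathbb{R}$ with finite first moment, and let $\tau \in (0,1)$. Then the following holds. (a) The $\tau$-expectile functional is elicitable relative to the class $\mathcal{F}$. (b) Suppose that the scoring function $S : I \times I \to [0,\infty)$ satisfies the following assumptions: (S0) $S(x,y) \ge 0$ with equality if $x = y$; (S1) $S(x,y)$ is continuous in $x$; (S2) the partial derivative $S_{(1)}(x,y)$ of $S$ with respect to its first argument exists and is continuous in $x$ whenever $x \ne y$. Then $S$ is consistent for the $\tau$-expectile relative to the class of the compactly supported probability measures on $I$ if, and only if, it is of the form $$S(x,y) = |\mathbf{1}(x \ge y) - \tau| \, \bigl( \phi(y) - \phi(x) - \phi'(x)\,(y - x) \bigr), \qquad x, y \in I, \qquad (\ast)$$ where $\phi$ is a convex function with subgradient $\phi'$ on $I$. (c) If $\phi$ is strictly convex (with subgradient $\phi'$ on $I$), the scoring function $(\ast)$ is strictly consistent for the $\tau$-expectile relative to the class of the probability measures $F$ on $I$ for which both $\mathbb{E}_F Y$ and $\mathbb{E}_F \phi(Y)$ exist and are finite.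
   Context: $Y$ denotes a random variable with distribution $F$, and $\mathbf{1}(\cdot)$ is an indicator function. For $0 < \tau < 1$, the $\tau$-expectile of a probability measure $F$ with finite mean is the unique solution $x = \mu_\tau$ to $$\tau \int_x^\infty (y - x)\, dF(y) = (1 - \tau) \int_{-\infty}^x (x - y)\, dF(y).$$ A scoring function is a map $S : I \times I \to [0,\infty)$ (point forecast $x$ first, observation $y$ second), measurable in the second argument, so that $\mathbb{E}_F S(x,Y) \in [0,\infty]$ is defined. For a class $\mathcal{G}$ of probability measures on $I$ and a functional $T : \mathcal{G} \to I$, $S$ is consistent for $T$ relative to $\mathcal{G}$ if $$\mathbb{E}_F S(T(F),Y) \le \mathbb{E}_F S(x,Y) \quad \text{for all } F \in \mathcal{G} \text{ and all } x \in I.$$ It is strictly consistent if it is consistent and equality in this inequality implies that $x = T(F)$. The functional $T$ is elicitable relative to $\mathcal{G}$ if there exists a scoring function that is strictly consistent for $T$ relative to $\mathcal{G}$. "$\phi$ is a convex function with subgradient $\phi'$ on $I$" means that $\phi : I \to \mathbb{R}$ is convex and $\phi' : I \to \mathbb{R}$ satisfies $\phi(y) \ge \phi(x) + \phi'(x)(y - x)$ for all $x, y \in I$. "Compactly supported probability measures on $I$" are those supported in a compact subset of $I$. *)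

theory Defs
  imports "HOL-Probability.Probability"
begin

definition prob_measures_on :: "real set \<Rightarrow> real measure set" where
  "prob_measures_on I = {M. prob_space M \<and> sets M = sets (restrict_space borel I)}"

definition finite_mean_measures :: "real set \<Rightarrow> real measure set" where
  "finite_mean_measures I = {M \<in> prob_measures_on I. integrable M (\<lambda>y. y)}"

definition compactly_supported_measures :: "real set \<Rightarrow> real measure set" where
  "compactly_supported_measures I =
     {M \<in> prob_measures_on I. \<exists>K. compact K \<and> K \<subseteq> I \<and> (AE y in M. y \<in> K)}"

definition expectile :: "real \<Rightarrow> real measure \<Rightarrow> real" where
  "expectile \<tau> M =
     (THE x. \<tau> * (LINT y:{x..}|M. y - x) = (1 - \<tau>) * (LINT y:{..x}|M. x - y))"

text \<open>Scores are total functions on the reals; only their values on \<open>I \<times> I\<close> are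
  constrained or used.\<close>

definition scoring_function :: "real set \<Rightarrow> (real \<Rightarrow> real \<Rightarrow> real) \<Rightarrow> bool" where
  "scoring_function I S \<longleftrightarrow>
     (\<forall>x\<in>I. \<forall>y\<in>I. 0 \<le> S x y) \<and> (\<forall>x\<in>I. S x \<in> borel_measurable (restrict_space borel I))"

definition expected_score :: "(real \<Rightarrow> real \<Rightarrow> real) \<Rightarrow> real measure \<Rightarrow> real \<Rightarrow> ennreal" where
  "expected_score S M x = (\<integral>\<^sup>+ y. ennreal (S x y) \<partial>M)"

text \<open>The conjunct \<open>T \<in> G \<rightarrow> I\<close> is the typing of the functional \<open>T\<close>: without it, the
  value of \<open>S (T M)\<close> could be unconstrained.\<close>

definition consistent ::
  "real set \<Rightarrow> real measure set \<Rightarrow> (real measure \<Rightarrow> real) \<Rightarrow> (real \<Rightarrow> real \<Rightarrow> real) \<Rightarrow> bool" where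
  "consistent I G T S \<longleftrightarrow> T \<in> G \<rightarrow> I \<and>
     (\<forall>M\<in>G. \<forall>x\<in>I. expected_score S M (T M) \<le> expected_score S M x)"

definition strictly_consistent ::
  "real set \<Rightarrow> real measure set \<Rightarrow> (real measure \<Rightarrow> real) \<Rightarrow> (real \<Rightarrow> real \<Rightarrow> real) \<Rightarrow> bool" where
  "strictly_consistent I G T S \<longleftrightarrow> consistent I G T S \<and>
     (\<forall>M\<in>G. \<forall>x\<in>I. expected_score S M (T M) = expected_score S M x \<longrightarrow> x = T M)"

definition elicitable ::
  "real set \<Rightarrow> real measure set \<Rightarrow> (real measure \<Rightarrow> real) \<Rightarrow> bool" where
  "elicitable I G T \<longleftrightarrow> (\<exists>S. scoring_function I S \<and> strictly_consistent I G T S)"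

definition score_S0 :: "real set \<Rightarrow> (real \<Rightarrow> real \<Rightarrow> real) \<Rightarrow> bool" where
  "score_S0 I S \<longleftrightarrow> (\<forall>x\<in>I. \<forall>y\<in>I. 0 \<le> S x y \<and> (x = y \<longrightarrow> S x y = 0))"

definition score_S1 :: "real set \<Rightarrow> (real \<Rightarrow> real \<Rightarrow> real) \<Rightarrow> bool" where
  "score_S1 I S \<longleftrightarrow> (\<forall>y\<in>I. continuous_on I (\<lambda>x. S x y))"

text \<open>The derivative is relative to \<open>I\<close>, hence one-sided at an endpoint belonging to \<open>I\<close>.\<close>

definition score_S2 :: "real set \<Rightarrow> (real \<Rightarrow> real \<Rightarrow> real) \<Rightarrow> bool" where
  "score_S2 I S \<longleftrightarrow> (\<forall>y\<in>I. \<exists>S\<^sub>1.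
     (\<forall>x\<in>I - {y}. ((\<lambda>x. S x y) has_real_derivative S\<^sub>1 x) (at x within I)) \<and>
     continuous_on (I - {y}) S\<^sub>1)"

definition subgradient_on :: "real set \<Rightarrow> (real \<Rightarrow> real) \<Rightarrow> (real \<Rightarrow> real) \<Rightarrow> bool" where
  "subgradient_on I \<phi> \<phi>' \<longleftrightarrow> (\<forall>x\<in>I. \<forall>y\<in>I. \<phi> y \<ge> \<phi> x + \<phi>' x * (y - x))"

definition strictly_convex_on :: "real set \<Rightarrow> (real \<Rightarrow> real) \<Rightarrow> bool" where
  "strictly_convex_on I \<phi> \<longleftrightarrow> convex I \<and>
     (\<forall>x\<in>I. \<forall>y\<in>I. \<forall>u>0. \<forall>v>0. x \<noteq> y \<longrightarrow> u + v = 1 \<longrightarrow>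
        \<phi> (u * x + v * y) < u * \<phi> x + v * \<phi> y)"

definition expectile_score ::
  "real \<Rightarrow> (real \<Rightarrow> real) \<Rightarrow> (real \<Rightarrow> real) \<Rightarrow> real \<Rightarrow> real \<Rightarrow> real" where
  "expectile_score \<tau> \<phi> \<phi>' x y =
     \<bar>of_bool (x \<ge> y) - \<tau>\<bar> * (\<phi> y - \<phi> x - \<phi>' x * (y - x))"

end

theory Submission
  imports Defs
begin

text \<open>
  Write \<open>w(x, y)\<close> for the asymmetric weight \<open>\<bar>1(x \<ge> y) - \<tau>\<bar>\<close>, \<open>V(x, y) = w(x, y) (y - x)\<close>,
  and \<open>B(x, y) = \<phi> y - \<phi> x - \<phi>' x (y - x)\<close> for the Bregman function of \<open>\<phi>\<close>. The defining
  equation of the expectile says \<open>E V(x, Y) = 0\<close>. As a function of \<open>x\<close>, \<open>V\<close> decreases with slope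
  between \<open>min \<tau> (1 - \<tau>)\<close> and \<open>1\<close>, uniformly in \<open>y\<close>; hence so does its expectation, which
  therefore has exactly one zero, and this zero lies in \<open>I\<close>
  (\<open>expectile_equation_ex1\<close>, \<open>expectile_in_interval\<close>).

  Sufficiency rests on one pointwise inequality for \<open>S = w B\<close> (\<open>expectile_score_regret\<close>):
  \<open>S(x, y) \<ge> S(t, y) + min \<tau> (1 - \<tau>) B(x, t) + (\<phi>' t - \<phi>' x) V(t, y)\<close>.
  At \<open>t\<close> equal to the expectile the last term has expectation zero, so the regret of forecasting
  \<open>x\<close> is at least \<open>min \<tau> (1 - \<tau>) B(x, t)\<close>, which is nonnegative, and positive for \<open>x \<noteq> t\<close> if
  \<open>\<phi>\<close> is strictly convex. Elicitability for all laws with finite mean follows with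
  \<open>\<phi> y = sqrt (1 + y\<^sup>2)\<close>, which is strictly convex but grows only linearly.

  Necessity is Osband's principle. Testing a consistent \<open>S\<close> on two-point laws with masses at
  \<open>a < x < b\<close> chosen so that the expectile is \<open>x\<close> gives a first-order condition, and
  varying \<open>a\<close> and \<open>b\<close> shows that the \<open>x\<close>-derivative of \<open>S(x, y) / w(x, y)\<close> is \<open>(x - y) h(x)\<close> with
  \<open>h\<close> not depending on \<open>y\<close> (\<open>consistent_osband\<close>). The usual next step integrates \<open>h\<close> twice. Here
  \<open>\<phi>\<close> is read off instead: differences of \<open>S(x, y) / w(x, y)\<close> in \<open>y\<close> have derivatives
  proportional to \<open>h\<close>, so up to additive constants they are multiples of one function, and this
  linear relation yields \<open>S / w = B\<close> with \<open>\<phi> y = S(y\<^sub>0, y) / w(y\<^sub>0, y)\<close> for a reference point \<open>y\<^sub>0\<close>. That \<open>\<phi>\<close> is convex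
  with subgradient \<open>\<phi>'\<close> is then the nonnegativity of \<open>S\<close>.
\<close>

section \<open>The expectile as the zero of an expected identification function\<close>

definition asym_weight :: "real \<Rightarrow> real \<Rightarrow> real \<Rightarrow> real" where
  "asym_weight \<tau> x y = \<bar>of_bool (x \<ge> y) - \<tau>\<bar>"

definition expectile_identification :: "real \<Rightarrow> real \<Rightarrow> real \<Rightarrow> real" where
  "expectile_identification \<tau> x y = asym_weight \<tau> x y * (y - x)"

lemma asym_weight_eq:
  assumes "0 < \<tau>" "\<tau> < 1"
  shows "asym_weight \<tau> x y = (if y \<le> x then 1 - \<tau> else \<tau>)"
  using assms by (auto simp: asym_weight_def)

lemma asym_weight_pos:
  assumes "0 < \<tau>" "\<tau> < 1"
  shows "0 < asym_weight \<tau> x y"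
  using assms by (simp add: asym_weight_eq)

lemma prob_measures_onD:
  assumes "M \<in> prob_measures_on I"
  shows "prob_space M" "sets M = sets (restrict_space borel I)" "space M = I"
proof -
  show "prob_space M" and s: "sets M = sets (restrict_space borel I)"
    using assms by (auto simp: prob_measures_on_def)
  show "space M = I"
    using sets_eq_imp_space_eq[OF s] by (simp add: space_restrict_space)
qed

lemma borel_measurable_prob_measures_on:
  assumes "M \<in> prob_measures_on I" "f \<in> borel_measurable (restrict_space borel I)"
  shows "f \<in> borel_measurable M"
  using assms(2) measurable_cong_sets[OF prob_measures_onD(2)[OF assms(1)] refl] by blast

lemma asym_weight_measurable: "asym_weight \<tau> x \<in> borel_measurable borel"
  unfolding asym_weight_def by measurable

lemma integrable_expectile_identification:
  assumes "0 < \<tau>" "\<tau> < 1" "M \<in> finite_mean_measures I"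
  shows "integrable M (expectile_identification \<tau> x)"
proof -
  have M: "M \<in> prob_measures_on I" and int: "integrable M (\<lambda>y. y)"
    using assms(3) by (auto simp: finite_mean_measures_def)
  interpret prob_space M by (rule prob_measures_onD(1)[OF M])
  have "integrable M (\<lambda>y. y - x)" using int by simp
  then show ?thesis
  proof (rule Bochner_Integration.integrable_bound)
    have "expectile_identification \<tau> x \<in> borel_measurable borel"
      unfolding expectile_identification_def using asym_weight_measurable by measurable
    then show "expectile_identification \<tau> x \<in> borel_measurable M"
      using M borel_measurable_prob_measures_on measurable_restrict_space1 by blast
    show "AE y in M. norm (expectile_identification \<tau> x y) \<le> norm (y - x)"
      using assms(1,2)
      by (auto simp: expectile_identification_def asym_weight_eq abs_mult
          intro!: AE_I2 mult_left_le_one_le)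
  qed
qed

text \<open>The point \<open>y = x\<close>, which belongs to both integrals of the defining equation,
  contributes zero to each, so both sides combine into a single expectation.\<close>

lemma expectile_equation_iff:
  assumes "0 < \<tau>" "\<tau> < 1" "M \<in> finite_mean_measures I"
  shows "\<tau> * (LINT y:{x..}|M. y - x) = (1 - \<tau>) * (LINT y:{..x}|M. x - y)
    \<longleftrightarrow> (LINT y|M. expectile_identification \<tau> x y) = 0"
proof -
  have M: "M \<in> prob_measures_on I" and int: "integrable M (\<lambda>y. y)"
    using assms(3) by (auto simp: finite_mean_measures_def)
  interpret prob_space M by (rule prob_measures_onD(1)[OF M])
  have part: "integrable M (\<lambda>y. indicat_real A y * f y)"
    if "A \<in> sets borel" "integrable M f" for A :: "real set" and f :: "real \<Rightarrow> real"
  proof (rule Bochner_Integration.integrable_bound[OF that(2)])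
    have "indicat_real A \<in> borel_measurable M"
      using that(1) by (intro borel_measurable_prob_measures_on[OF M] measurable_restrict_space1) simp
    then show "(\<lambda>y. indicat_real A y * f y) \<in> borel_measurable M"
      using that(2) by measurable
    show "AE y in M. norm (indicat_real A y * f y) \<le> norm (f y)"
      by (auto simp: indicator_def)
  qed
  have 1: "integrable M (\<lambda>y. indicat_real {x..} y * (y - x))"
    and 2: "integrable M (\<lambda>y. indicat_real {..x} y * (x - y))"
    using int by (simp_all add: part)
  have "expectile_identification \<tau> x y
      = \<tau> * (indicat_real {x..} y * (y - x)) - (1 - \<tau>) * (indicat_real {..x} y * (x - y))" for y
    using assms(1,2)
    by (cases y x rule: linorder_cases)
      (simp_all add: expectile_identification_def asym_weight_eq algebra_simps)
  then have "(LINT y|M. expectile_identification \<tau> x y)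
      = \<tau> * (LINT y:{x..}|M. y - x) - (1 - \<tau>) * (LINT y:{..x}|M. x - y)"
    using 1 2 by (simp add: set_lebesgue_integral_def)
  then show ?thesis by simp
qed

text \<open>The lower slope bound makes the expected identification function strictly
  decreasing and unbounded in both directions, the upper one makes it continuous.\<close>

lemma expectile_identification_decreasing:
  assumes "0 < \<tau>" "\<tau> < 1" "x \<le> x'"
  shows "min \<tau> (1 - \<tau>) * (x' - x) \<le> expectile_identification \<tau> x y - expectile_identification \<tau> x' y"
    and "expectile_identification \<tau> x y - expectile_identification \<tau> x' y \<le> x' - x"
proof -
  let ?m = "min \<tau> (1 - \<tau>)"
  have m: "?m \<le> \<tau>" "?m \<le> 1 - \<tau>" "0 \<le> ?m" using assms by auto
  consider "y \<le> x" | "x < y" "y \<le> x'" | "x' < y" by linarith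
  then show "?m * (x' - x) \<le> expectile_identification \<tau> x y - expectile_identification \<tau> x' y"
  proof cases
    case 1
    have "?m * (x' - x) \<le> (1 - \<tau>) * (x' - x)" using m assms(3) by (intro mult_right_mono) auto
    with 1 assms show ?thesis
      by (simp add: expectile_identification_def asym_weight_eq algebra_simps)
  next
    case 2
    have "?m * (x' - y) \<le> (1 - \<tau>) * (x' - y)" "?m * (y - x) \<le> \<tau> * (y - x)"
      using m 2 by (intro mult_right_mono; auto)+
    with 2 assms show ?thesis
      by (simp add: expectile_identification_def asym_weight_eq algebra_simps)
  next
    case 3
    have "?m * (x' - x) \<le> \<tau> * (x' - x)" using m assms(3) by (intro mult_right_mono) auto
    with 3 assms show ?thesis
      by (simp add: expectile_identification_def asym_weight_eq algebra_simps)
  qed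
  have le: "c * d \<le> d" if "c \<le> 1" "0 \<le> d" for c d :: real
    using mult_right_mono[OF that] by simp
  consider "y \<le> x" | "x < y" "y \<le> x'" | "x' < y" by linarith
  then show "expectile_identification \<tau> x y - expectile_identification \<tau> x' y \<le> x' - x"
  proof cases
    case 1
    with assms le[of "1 - \<tau>" "x' - x"] show ?thesis
      by (simp add: expectile_identification_def asym_weight_eq algebra_simps)
  next
    case 2
    then have "\<tau> * (y - x) \<le> y - x" "(1 - \<tau>) * (x' - y) \<le> x' - y"
      using assms by (intro le; simp)+
    then have "\<tau> * (y - x) + (1 - \<tau>) * (x' - y) \<le> x' - x" by linarith
    with 2 assms show ?thesis
      by (simp add: expectile_identification_def asym_weight_eq algebra_simps)
  next
    case 3
    with assms le[of \<tau> "x' - x"] show ?thesis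
      by (simp add: expectile_identification_def asym_weight_eq algebra_simps)
  qed
qed

lemma expectile_equation_ex1:
  assumes "0 < \<tau>" "\<tau> < 1" "M \<in> finite_mean_measures I"
  shows "\<exists>!x. (LINT y|M. expectile_identification \<tau> x y) = 0"
proof -
  have M: "M \<in> prob_measures_on I" using assms(3) by (auto simp: finite_mean_measures_def)
  interpret prob_space M by (rule prob_measures_onD(1)[OF M])
  define G where "G x = (LINT y|M. expectile_identification \<tau> x y)" for x
  define m where "m = min \<tau> (1 - \<tau>)"
  have m: "0 < m" using assms by (simp add: m_def)
  note int = integrable_expectile_identification[OF assms]
  have diff: "G x - G x' = (LINT y|M. expectile_identification \<tau> x y - expectile_identification \<tau> x' y)"
    for x x' using int by (simp add: G_def)
  have const: "(LINT y|M. c) = c" for c :: real by (simp add: prob_space)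
  have lower: "m * (x' - x) \<le> G x - G x'" if "x \<le> x'" for x x'
  proof -
    have "(LINT y|M. m * (x' - x)) \<le> G x - G x'"
      unfolding diff using expectile_identification_decreasing(1)[OF assms(1,2) that] int
      by (intro integral_mono) (auto simp: m_def)
    then show ?thesis unfolding const .
  qed
  have upper: "G x - G x' \<le> x' - x" if "x \<le> x'" for x x'
  proof -
    have "G x - G x' \<le> (LINT y|M. x' - x)"
      unfolding diff using expectile_identification_decreasing(2)[OF assms(1,2) that] int
      by (intro integral_mono) auto
    then show ?thesis unfolding const .
  qed
  have lip: "\<bar>G x' - G x\<bar> \<le> \<bar>x' - x\<bar>" for x x'
  proof -
    have mono: "0 \<le> G a - G b" if "a \<le> b" for a b
      using lower[OF that] m that by (smt (verit) mult_nonneg_nonneg)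
    show ?thesis
      using upper[of x x'] upper[of x' x] mono[of x x'] mono[of x' x] by linarith
  qed
  have cont: "continuous_on UNIV G"
    unfolding continuous_on_iff dist_real_def using lip by (meson le_less_trans)
  \<comment> \<open>Since \<open>G\<close> drops at rate at least \<open>m\<close>, it has changed its sign between \<open>0\<close> and \<open>G 0 / m\<close>.\<close>
  have "\<exists>x. G x = 0"
  proof (cases "0 \<le> G 0")
    case True
    have "G (G 0 / m) \<le> 0" using lower[of 0 "G 0 / m"] True m by simp
    then show ?thesis
      using IVT2'[of G "G 0 / m" 0 0] True m continuous_on_subset[OF cont] by auto
  next
    case False
    have "0 \<le> G (G 0 / m)" using lower[of "G 0 / m" 0] False m by (simp add: divide_nonpos_pos)
    then show ?thesis
      using IVT2'[of G 0 0 "G 0 / m"] False m continuous_on_subset[OF cont]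
      by (auto simp: divide_nonpos_pos)
  qed
  moreover have "x = x'" if "G x = 0" "G x' = 0" for x x'
  proof -
    have "m * \<bar>x' - x\<bar> \<le> 0" using lower[of x x'] lower[of x' x] that by (cases "x \<le> x'") auto
    then show ?thesis using m by (simp add: mult_le_0_iff)
  qed
  ultimately show ?thesis unfolding G_def by blast
qed

lemma expectile_eq_iff:
  assumes "0 < \<tau>" "\<tau> < 1" "M \<in> finite_mean_measures I"
  shows "expectile \<tau> M = x \<longleftrightarrow> (LINT y|M. expectile_identification \<tau> x y) = 0"
proof -
  have E: "expectile \<tau> M = (THE x. (LINT y|M. expectile_identification \<tau> x y) = 0)"
    unfolding expectile_def expectile_equation_iff[OF assms] ..
  note ex1 = expectile_equation_ex1[OF assms]
  show ?thesis
    unfolding E by (auto intro: theI'[OF ex1] the1_equality[OF ex1])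
qed

text \<open>A point outside an interval lies strictly on one side of it, so the
  identification function there has one strict sign on all of \<open>I\<close> and cannot average to zero.\<close>

lemma expectile_in_interval:
  assumes "0 < \<tau>" "\<tau> < 1" "M \<in> finite_mean_measures I" "is_interval I"
  shows "expectile \<tau> M \<in> I"
proof (rule ccontr)
  let ?t = "expectile \<tau> M"
  assume t: "?t \<notin> I"
  have M: "M \<in> prob_measures_on I" using assms(3) by (auto simp: finite_mean_measures_def)
  interpret prob_space M by (rule prob_measures_onD(1)[OF M])
  note int = integrable_expectile_identification[OF assms(1-3)]
  have zero: "(LINT y|M. expectile_identification \<tau> ?t y) = 0"
    using expectile_eq_iff[OF assms(1-3)] by blast
  \<comment> \<open>The factor \<open>c\<close> is \<open>1\<close> or \<open>-1\<close> and treats both sides at once.\<close>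
  have pos: False if "\<And>y. y \<in> I \<Longrightarrow> 0 < c * expectile_identification \<tau> ?t y" for c
  proof -
    have "(LINT y|M. c * expectile_identification \<tau> ?t y) = 0" using zero by simp
    moreover have "(LINT y|M. c * expectile_identification \<tau> ?t y) = 0
        \<longleftrightarrow> (AE y in M. c * expectile_identification \<tau> ?t y = 0)"
      using int that prob_measures_onD(3)[OF M]
      by (intro integral_nonneg_eq_0_iff_AE) (auto intro!: AE_I2 less_imp_le)
    ultimately have "AE y in M. c * expectile_identification \<tau> ?t y = 0" by blast
    moreover have "AE y in M. c * expectile_identification \<tau> ?t y \<noteq> 0"
      using that prob_measures_onD(3)[OF M] by (intro AE_I2) fastforce
    ultimately have "AE y in M. False" by eventually_elim auto
    then show False by simp
  qed
  have sep: "(\<forall>y\<in>I. ?t < y) \<or> (\<forall>y\<in>I. y < ?t)"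
    using t assms(4) unfolding is_interval_1 by (meson linorder_le_less_linear)
  then show False
  proof
    assume above: "\<forall>y\<in>I. ?t < y"
    have "0 < 1 * expectile_identification \<tau> ?t y" if "y \<in> I" for y
      using above that asym_weight_pos[OF assms(1,2), of ?t y]
      by (simp add: expectile_identification_def)
    then show False by (rule pos)
  next
    assume below: "\<forall>y\<in>I. y < ?t"
    have "0 < - 1 * expectile_identification \<tau> ?t y" if "y \<in> I" for y
      using below that mult_pos_neg[OF asym_weight_pos[OF assms(1,2), of ?t y], of "y - ?t"]
      by (simp add: expectile_identification_def)
    then show False by (rule pos)
  qed
qed

section \<open>Scores from convex functions are consistent\<close>

definition bregman :: "(real \<Rightarrow> real) \<Rightarrow> (real \<Rightarrow> real) \<Rightarrow> real \<Rightarrow> real \<Rightarrow> real" where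
  "bregman \<phi> \<phi>' x y = \<phi> y - \<phi> x - \<phi>' x * (y - x)"

lemma expectile_score_eq:
  "expectile_score \<tau> \<phi> \<phi>' x y = asym_weight \<tau> x y * bregman \<phi> \<phi>' x y"
  by (simp add: expectile_score_def asym_weight_def bregman_def)

lemma bregman_nonneg:
  assumes "subgradient_on I \<phi> \<phi>'" "x \<in> I" "y \<in> I"
  shows "0 \<le> bregman \<phi> \<phi>' x y"
  using assms by (auto simp: subgradient_on_def bregman_def algebra_simps)

lemma convex_on_if_subgradient_on:
  assumes "convex I" "subgradient_on I \<phi> \<phi>'"
  shows "convex_on I \<phi>"
proof (rule convex_onI[OF _ assms(1)])
  fix u x y :: real
  assume u: "0 < u" "u < 1" and xy: "x \<in> I" "y \<in> I"
  define z where "z = (1 - u) *\<^sub>R x + u *\<^sub>R y"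
  have z: "z \<in> I" using assms(1) u xy unfolding z_def convex_alt by auto
  have "(1 - u) * (\<phi> z + \<phi>' z * (x - z)) \<le> (1 - u) * \<phi> x"
    "u * (\<phi> z + \<phi>' z * (y - z)) \<le> u * \<phi> y"
    using assms(2) z xy u by (intro mult_left_mono; auto simp: subgradient_on_def)+
  moreover have "(1 - u) * (\<phi> z + \<phi>' z * (x - z)) + u * (\<phi> z + \<phi>' z * (y - z)) = \<phi> z"
    by (simp add: z_def algebra_simps)
  ultimately show "\<phi> ((1 - u) *\<^sub>R x + u *\<^sub>R y) \<le> (1 - u) * \<phi> x + u * \<phi> y"
    unfolding z_def[symmetric] by linarith
qed

lemma subgradient_mono:
  assumes "subgradient_on I \<phi> \<phi>'" "x \<in> I" "y \<in> I" "x \<le> y"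
  shows "\<phi>' x \<le> \<phi>' y"
proof (cases "x = y")
  case False
  have "\<phi>' x * (y - x) \<le> \<phi>' y * (y - x)"
    using bregman_nonneg[OF assms(1-3)] bregman_nonneg[OF assms(1,3,2)]
    by (simp add: bregman_def algebra_simps)
  then show ?thesis using False assms(4) by simp
qed simp

text \<open>Monotonicity of the subgradient makes the Bregman function grow, weakly, as the observation
  moves away from the forecast.\<close>

lemma bregman_le_between:
  assumes "subgradient_on I \<phi> \<phi>'" "x \<in> I" "y \<in> I" "t \<in> I"
    and between: "x \<le> y \<and> y \<le> t \<or> t \<le> y \<and> y \<le> x"
  shows "bregman \<phi> \<phi>' x y \<le> bregman \<phi> \<phi>' x t"
proof -
  have "bregman \<phi> \<phi>' x t - bregman \<phi> \<phi>' x y = bregman \<phi> \<phi>' y t + (\<phi>' y - \<phi>' x) * (t - y)"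
    by (simp add: bregman_def algebra_simps)
  moreover have "0 \<le> (\<phi>' y - \<phi>' x) * (t - y)"
    using between subgradient_mono[OF assms(1,2,3)] subgradient_mono[OF assms(1,3,2)]
    by (auto intro: mult_nonneg_nonneg mult_nonpos_nonpos)
  ultimately show ?thesis using bregman_nonneg[OF assms(1,3,4)] by linarith
qed

text \<open>By the three-point identity for Bregman functions the score difference, up to the
  term in the identification function, is
  \<open>w(t, y) B(x, t) + (w(x, y) - w(t, y)) B(x, y)\<close>. A smaller weight at \<open>x\<close> is possible only if \<open>y\<close>
  lies between \<open>x\<close> and \<open>t\<close>; then \<open>B(x, y) \<le> B(x, t)\<close>, and at least
  \<open>w(x, y) B(x, t)\<close> remains.\<close>

lemma expectile_score_regret:
  assumes \<tau>: "0 < \<tau>" "\<tau> < 1" and "subgradient_on I \<phi> \<phi>'" "x \<in> I" "y \<in> I" "t \<in> I"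
  shows "expectile_score \<tau> \<phi> \<phi>' t y + min \<tau> (1 - \<tau>) * bregman \<phi> \<phi>' x t
      + (\<phi>' t - \<phi>' x) * expectile_identification \<tau> t y \<le> expectile_score \<tau> \<phi> \<phi>' x y"
proof -
  let ?B = "bregman \<phi> \<phi>'" and ?m = "min \<tau> (1 - \<tau>)"
  let ?c = "asym_weight \<tau> t y" and ?d = "asym_weight \<tau> x y"
  have B: "0 \<le> ?B x t" "0 \<le> ?B x y" using bregman_nonneg assms by blast+
  have three_point: "?B x y = ?B t y + ?B x t + (\<phi>' t - \<phi>' x) * (y - t)"
    by (simp add: bregman_def algebra_simps)
  have "?d * ?B x y - ?c * ?B t y - (\<phi>' t - \<phi>' x) * (?c * (y - t))
      = ?c * ?B x t + (?d - ?c) * ?B x y"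
    unfolding three_point by (simp add: algebra_simps)
  moreover have "?m * ?B x t \<le> ?c * ?B x t + (?d - ?c) * ?B x y"
  proof (cases "?c \<le> ?d")
    case True
    then have "0 \<le> (?d - ?c) * ?B x y" using B by simp
    moreover have "?m * ?B x t \<le> ?c * ?B x t"
      using B \<tau> by (intro mult_right_mono) (auto simp: asym_weight_eq)
    ultimately show ?thesis by linarith
  next
    case False
    then have "x \<le> y \<and> y \<le> t \<or> t \<le> y \<and> y \<le> x"
      using \<tau> by (auto simp: asym_weight_eq split: if_splits)
    then have "?B x y \<le> ?B x t" using bregman_le_between assms by blast
    then have "(?c - ?d) * ?B x y \<le> (?c - ?d) * ?B x t"
      using False by (intro mult_left_mono) auto
    moreover have "?m * ?B x t \<le> ?d * ?B x t"
      using B \<tau> by (intro mult_right_mono) (auto simp: asym_weight_eq)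
    ultimately show ?thesis by (simp add: algebra_simps)
  qed
  ultimately show ?thesis
    unfolding expectile_score_eq expectile_identification_def by linarith
qed

text \<open>Sublevel sets of a convex function are convex, hence intervals. In contrast to an argument
  by continuity, this covers the endpoints of \<open>I\<close> as well.\<close>

lemma convex_on_measurable:
  assumes "convex_on I (\<phi> :: real \<Rightarrow> real)"
  shows "\<phi> \<in> borel_measurable (restrict_space borel I)"
proof (rule borel_measurableI_le)
  fix a
  have "convex {y \<in> I. \<phi> y \<le> a}"
  proof (rule convexI)
    fix x y u v :: real
    assume x: "x \<in> {y \<in> I. \<phi> y \<le> a}" and y: "y \<in> {y \<in> I. \<phi> y \<le> a}"
      and uv: "0 \<le> u" "0 \<le> v" "u + v = 1"
    have "u * \<phi> x + v * \<phi> y \<le> a"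
      using x y uv convex_bound_le[of "\<phi> x" a "\<phi> y" u v] by auto
    moreover have "\<phi> (u *\<^sub>R x + v *\<^sub>R y) \<le> u * \<phi> x + v * \<phi> y"
      using assms x y uv by (auto simp: convex_on_def)
    moreover have "u *\<^sub>R x + v *\<^sub>R y \<in> I"
      using convex_on_imp_convex[OF assms] x y uv by (auto simp: convex_def)
    ultimately show "u *\<^sub>R x + v *\<^sub>R y \<in> {y \<in> I. \<phi> y \<le> a}" by auto
  qed
  then have "{y \<in> I. \<phi> y \<le> a} \<in> sets borel"
    by (intro real_interval_borel_measurable) (simp add: is_interval_convex_1)
  then show "{x \<in> space (restrict_space borel I). \<phi> x \<le> a} \<in> sets (restrict_space borel I)"
    by (auto simp: space_restrict_space sets_restrict_space)
qed

lemma scoring_function_expectile_score: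
  assumes "convex_on I \<phi>" "subgradient_on I \<phi> \<phi>'"
  shows "scoring_function I (expectile_score \<tau> \<phi> \<phi>')"
proof -
  have [measurable]: "\<phi> \<in> borel_measurable (restrict_space borel I)"
    by (rule convex_on_measurable[OF assms(1)])
  have [measurable]: "asym_weight \<tau> x \<in> borel_measurable (restrict_space borel I)"
    "(\<lambda>y. y) \<in> borel_measurable (restrict_space borel I)" for x
    by (simp_all add: asym_weight_measurable measurable_restrict_space1)
  have "expectile_score \<tau> \<phi> \<phi>' x \<in> borel_measurable (restrict_space borel I)" for x
    unfolding expectile_score_eq bregman_def by measurable
  then show ?thesis
    using bregman_nonneg[OF assms(2)]
    by (auto simp: scoring_function_def expectile_score_eq asym_weight_def)
qed

text \<open>The pointwise regret inequality is integrated over \<open>y\<close> with \<open>t\<close> the expectile. Finiteness of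
  the expected score is what allows strict inequalities to be concluded from it in \<open>ennreal\<close>.\<close>

lemma expected_expectile_score_regret:
  assumes \<tau>: "0 < \<tau>" "\<tau> < 1" and I: "is_interval I"
    and conv: "convex_on I \<phi>" and sub: "subgradient_on I \<phi> \<phi>'"
    and M: "M \<in> prob_measures_on I" and int: "integrable M (\<lambda>y. y)" "integrable M \<phi>"
    and x: "x \<in> I"
  shows "expected_score (expectile_score \<tau> \<phi> \<phi>') M (expectile \<tau> M)
      + ennreal (min \<tau> (1 - \<tau>) * bregman \<phi> \<phi>' x (expectile \<tau> M))
      \<le> expected_score (expectile_score \<tau> \<phi> \<phi>') M x"
    and "expected_score (expectile_score \<tau> \<phi> \<phi>') M x < \<infinity>"
proof -
  let ?S = "expectile_score \<tau> \<phi> \<phi>'" and ?t = "expectile \<tau> M"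
  let ?r = "min \<tau> (1 - \<tau>) * bregman \<phi> \<phi>' x ?t"
  interpret prob_space M by (rule prob_measures_onD(1)[OF M])
  have fin: "M \<in> finite_mean_measures I" using M int by (simp add: finite_mean_measures_def)
  have t: "?t \<in> I" by (rule expectile_in_interval[OF \<tau> fin I])
  have sf: "scoring_function I ?S" by (rule scoring_function_expectile_score[OF conv sub])
  have nonneg: "0 \<le> ?S z y" if "z \<in> I" "y \<in> I" for z y
    using sf that by (auto simp: scoring_function_def)
  have S_int: "integrable M (?S z)" if z: "z \<in> I" for z
  proof (rule Bochner_Integration.integrable_bound)
    show "integrable M (bregman \<phi> \<phi>' z)" unfolding bregman_def using int by simp
    show "?S z \<in> borel_measurable M"
      using sf z borel_measurable_prob_measures_on[OF M] by (auto simp: scoring_function_def)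
    show "AE y in M. norm (?S z y) \<le> norm (bregman \<phi> \<phi>' z y)"
      using \<tau> by (auto simp: expectile_score_eq asym_weight_eq abs_mult
          intro!: AE_I2 mult_left_le_one_le)
  qed
  have E: "expected_score ?S M z = ennreal (LINT y|M. ?S z y)" if "z \<in> I" for z
    unfolding expected_score_def using S_int[OF that] nonneg[OF that] prob_measures_onD(3)[OF M]
    by (intro nn_integral_eq_integral) (auto intro!: AE_I2)
  note id_int = integrable_expectile_identification[OF \<tau> fin, of ?t]
  have "(LINT y|M. ?S ?t y) + ?r
      = (LINT y|M. ?S ?t y + ?r + (\<phi>' ?t - \<phi>' x) * expectile_identification \<tau> ?t y)"
    using S_int[OF t] id_int expectile_eq_iff[OF \<tau> fin, of ?t]
    by (simp add: prob_space)
  also have "\<dots> \<le> (LINT y|M. ?S x y)"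
    using expectile_score_regret[OF \<tau> sub x _ t] S_int[OF t] S_int[OF x] id_int
      prob_measures_onD(3)[OF M]
    by (intro integral_mono) auto
  finally have "ennreal ((LINT y|M. ?S ?t y) + ?r) \<le> ennreal (LINT y|M. ?S x y)"
    by (rule ennreal_leI)
  moreover have "0 \<le> (LINT y|M. ?S ?t y)"
    using nonneg[OF t] prob_measures_onD(3)[OF M] by (intro integral_nonneg_AE) (auto intro!: AE_I2)
  moreover have "0 \<le> ?r" using \<tau> bregman_nonneg[OF sub x t] by auto
  ultimately show "expected_score ?S M ?t + ennreal ?r \<le> expected_score ?S M x"
    unfolding E[OF t] E[OF x] by (simp add: ennreal_plus)
  show "expected_score ?S M x < \<infinity>" unfolding E[OF x] by simp
qed

lemma strictly_convex_imp_convex_on: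
  assumes "strictly_convex_on I \<phi>"
  shows "convex_on I \<phi>"
proof -
  have c: "convex I" using assms by (simp add: strictly_convex_on_def)
  show ?thesis
  proof (rule convex_onI[OF _ c])
    fix t x y :: real
    assume "0 < t" "t < 1" "x \<in> I" "y \<in> I"
    moreover from this have "x \<noteq> y \<Longrightarrow> \<phi> ((1 - t) * x + t * y) < (1 - t) * \<phi> x + t * \<phi> y"
      using assms by (simp add: strictly_convex_on_def)
    moreover have "(1 - t) * x + t * x = x" "(1 - t) * \<phi> x + t * \<phi> x = \<phi> x"
      by (simp_all add: left_diff_distrib)
    ultimately show "\<phi> ((1 - t) *\<^sub>R x + t *\<^sub>R y) \<le> (1 - t) * \<phi> x + t * \<phi> y"
      by (cases "x = y") auto
  qed
qed

lemma strictly_convex_bregman_pos: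
  assumes "strictly_convex_on I \<phi>" "subgradient_on I \<phi> \<phi>'" "x \<in> I" "y \<in> I" "x \<noteq> y"
  shows "0 < bregman \<phi> \<phi>' x y"
proof -
  define z where "z = 1/2 * x + 1/2 * y"
  have "\<And>u v. 0 < u \<Longrightarrow> 0 < v \<Longrightarrow> u + v = 1 \<Longrightarrow> \<phi> (u * x + v * y) < u * \<phi> x + v * \<phi> y"
    using assms by (simp add: strictly_convex_on_def)
  from this[of "1/2" "1/2"] have "\<phi> z < 1/2 * \<phi> x + 1/2 * \<phi> y" by (simp add: z_def)
  moreover have "z \<in> I"
    using assms(1,3,4) convexD[of I x y "1/2" "1/2"] by (auto simp: strictly_convex_on_def z_def)
  then have "0 \<le> bregman \<phi> \<phi>' x z" using bregman_nonneg[OF assms(2,3)] by blast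
  ultimately show ?thesis by (simp add: bregman_def z_def field_simps)
qed

lemma strictly_consistent_expectile_score:
  assumes \<tau>: "0 < \<tau>" "\<tau> < 1" and I: "is_interval I"
    and conv: "strictly_convex_on I \<phi>" and sub: "subgradient_on I \<phi> \<phi>'"
  shows "strictly_consistent I
    {M \<in> prob_measures_on I. integrable M (\<lambda>y. y) \<and> integrable M \<phi>}
    (expectile \<tau>) (expectile_score \<tau> \<phi> \<phi>')" (is "strictly_consistent I ?G _ ?S")
proof -
  note regret = expected_expectile_score_regret[OF \<tau> I strictly_convex_imp_convex_on[OF conv] sub]
  have t: "expectile \<tau> M \<in> I" if "M \<in> ?G" for M
    using that by (intro expectile_in_interval[OF \<tau> _ I]) (auto simp: finite_mean_measures_def)
  have "expected_score ?S M (expectile \<tau> M) \<le> expected_score ?S M x" if "M \<in> ?G" "x \<in> I" for M x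
  proof -
    have "expected_score ?S M (expectile \<tau> M)
        + ennreal (min \<tau> (1 - \<tau>) * bregman \<phi> \<phi>' x (expectile \<tau> M)) \<le> expected_score ?S M x"
      using that by (intro regret(1)) simp_all
    then show ?thesis by (rule order_trans[rotated]) simp
  qed
  moreover have "x = expectile \<tau> M"
    if "M \<in> ?G" "x \<in> I" "expected_score ?S M (expectile \<tau> M) = expected_score ?S M x" for M x
  proof (rule ccontr)
    assume "x \<noteq> expectile \<tau> M"
    then have "0 < min \<tau> (1 - \<tau>) * bregman \<phi> \<phi>' x (expectile \<tau> M)"
      using strictly_convex_bregman_pos[OF conv sub that(2) t[OF that(1)]] \<tau> by simp
    moreover have "expected_score ?S M x
        + ennreal (min \<tau> (1 - \<tau>) * bregman \<phi> \<phi>' x (expectile \<tau> M)) \<le> expected_score ?S M x + 0"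
      using that regret(1)[of M x] by simp
    moreover have "expected_score ?S M x < \<infinity>"
      using that by (intro regret(2)) simp_all
    ultimately show False
      by (simp only: ennreal_add_left_cancel_le) (simp add: ennreal_eq_0_iff)
  qed
  ultimately show ?thesis
    using t by (auto simp: strictly_consistent_def consistent_def)
qed

text \<open>This makes \<open>\<phi>\<close> integrable for all compactly supported laws. At the extreme points \<open>a\<close> and
  \<open>b\<close> of the compact set the subgradients are finite, since both points belong to \<open>I\<close>, and they
  bound the subgradients in between.\<close>

lemma subgradient_on_compact_bounded:
  assumes "subgradient_on I \<phi> \<phi>'" "compact K" "K \<subseteq> I"
  shows "\<exists>C. \<forall>y\<in>K. \<bar>\<phi> y\<bar> \<le> C"
proof (cases "K = {}")
  case False
  obtain a b where a: "a \<in> K" "\<forall>y\<in>K. a \<le> y" and b: "b \<in> K" "\<forall>y\<in>K. y \<le> b"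
    using compact_attains_inf[OF assms(2) False] compact_attains_sup[OF assms(2) False] by blast
  have "\<bar>\<phi> y\<bar> \<le> \<bar>\<phi> a\<bar> + (\<bar>\<phi>' a\<bar> + \<bar>\<phi>' b\<bar>) * (b - a)" if y: "y \<in> K" for y
  proof -
    have yab: "0 \<le> y - a" "y - a \<le> b - a" using a b y by auto
    have "\<phi> y \<le> \<phi> a + \<phi>' y * (y - a)"
      using bregman_nonneg[OF assms(1), of y a] a y assms(3) by (auto simp: bregman_def algebra_simps)
    moreover have "\<phi>' y * (y - a) \<le> \<phi>' b * (y - a)"
      using subgradient_mono[OF assms(1), of y b] a b y assms(3) by (intro mult_right_mono) auto
    moreover have "\<phi> a + \<phi>' a * (y - a) \<le> \<phi> y"
      using bregman_nonneg[OF assms(1), of a y] a y assms(3) by (auto simp: bregman_def algebra_simps)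
    moreover have "\<bar>c * (y - a)\<bar> \<le> \<bar>c\<bar> * (b - a)" for c
      using yab by (auto simp: abs_mult intro!: mult_left_mono)
    from this[of "\<phi>' a"] this[of "\<phi>' b"]
    have "\<bar>\<phi>' a * (y - a)\<bar> \<le> \<bar>\<phi>' a\<bar> * (b - a)" "\<bar>\<phi>' b * (y - a)\<bar> \<le> \<bar>\<phi>' b\<bar> * (b - a)" .
    moreover have "0 \<le> \<bar>\<phi>' a\<bar> * (b - a)" "0 \<le> \<bar>\<phi>' b\<bar> * (b - a)" using yab by auto
    ultimately show ?thesis by (simp add: distrib_right abs_le_iff) linarith
  qed
  then show ?thesis by blast
qed simp

lemma compactly_supported_integrable:
  assumes "M \<in> compactly_supported_measures I" "f \<in> borel_measurable (restrict_space borel I)"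
    and "\<And>K. compact K \<Longrightarrow> K \<subseteq> I \<Longrightarrow> \<exists>C. \<forall>y\<in>K. \<bar>f y\<bar> \<le> C"
  shows "integrable M (f :: real \<Rightarrow> real)"
proof -
  obtain K where M: "M \<in> prob_measures_on I" and K: "compact K" "K \<subseteq> I" "AE y in M. y \<in> K"
    using assms(1) by (auto simp: compactly_supported_measures_def)
  interpret prob_space M by (rule prob_measures_onD(1)[OF M])
  obtain C where "\<forall>y\<in>K. \<bar>f y\<bar> \<le> C" using assms(3)[OF K(1,2)] by blast
  with K(3) have "AE y in M. norm (f y) \<le> C" by auto
  then show ?thesis
    using borel_measurable_prob_measures_on[OF M assms(2)] by (rule integrable_const_bound)
qed

lemma compactly_supported_finite_mean:
  assumes "M \<in> compactly_supported_measures I"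
  shows "M \<in> finite_mean_measures I"
proof -
  have "integrable M (\<lambda>y. y)"
    by (rule compactly_supported_integrable[OF assms])
      (auto simp: measurable_restrict_space1 dest!: compact_imp_bounded simp: bounded_iff)
  then show ?thesis
    using assms by (auto simp: finite_mean_measures_def compactly_supported_measures_def)
qed

lemma consistent_expectile_score:
  assumes \<tau>: "0 < \<tau>" "\<tau> < 1" and I: "is_interval I"
    and conv: "convex_on I \<phi>" and sub: "subgradient_on I \<phi> \<phi>'"
    and S: "\<And>x y. x \<in> I \<Longrightarrow> y \<in> I \<Longrightarrow> S x y = expectile_score \<tau> \<phi> \<phi>' x y"
  shows "consistent I (compactly_supported_measures I) (expectile \<tau>) S"
  unfolding consistent_def
proof safe
  fix M assume M: "M \<in> compactly_supported_measures I"
  note fin = compactly_supported_finite_mean[OF M]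
  show t: "expectile \<tau> M \<in> I" by (rule expectile_in_interval[OF \<tau> fin I])
  fix x assume x: "x \<in> I"
  have Mp: "M \<in> prob_measures_on I" and iy: "integrable M (\<lambda>y. y)"
    using fin by (auto simp: finite_mean_measures_def)
  have i\<phi>: "integrable M \<phi>"
    by (rule compactly_supported_integrable[OF M convex_on_measurable[OF conv]
          subgradient_on_compact_bounded[OF sub]])
  have E: "expected_score S M z = expected_score (expectile_score \<tau> \<phi> \<phi>') M z" if "z \<in> I" for z
    unfolding expected_score_def using S[OF that] prob_measures_onD(3)[OF Mp]
    by (intro nn_integral_cong) auto
  show "expected_score S M (expectile \<tau> M) \<le> expected_score S M x"
    unfolding E[OF t] E[OF x]
    using expected_expectile_score_regret(1)[OF \<tau> I conv sub Mp iy i\<phi> x]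
    by (rule order_trans[OF add_increasing2, rotated 2]) auto
qed

section \<open>Every consistent score comes from a convex function\<close>

lemma two_point_measure:
  assumes p: "0 \<le> p" "p \<le> 1" and I: "a \<in> I" "b \<in> I"
  obtains M where "M \<in> compactly_supported_measures I"
    and "\<And>S x. S x \<in> borel_measurable (restrict_space borel I) \<Longrightarrow>
           expected_score S M x = ennreal p * ennreal (S x a) + ennreal (1 - p) * ennreal (S x b)"
    and "\<And>f. f \<in> borel_measurable borel \<Longrightarrow> (LINT y|M. f y :: real) = p * f a + (1 - p) * f b"
proof -
  let ?N = "restrict_space borel I :: real measure"
  let ?g = "\<lambda>c. if c then a else b"
  define M where "M = distr (measure_pmf (bernoulli_pmf p)) ?N ?g"
  have g: "?g \<in> measurable (measure_pmf (bernoulli_pmf p)) ?N"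
    using I by (auto simp: space_restrict_space)
  have "prob_space M" unfolding M_def
    by (rule prob_space.prob_space_distr[OF measure_pmf.prob_space_axioms g])
  then have Mp: "M \<in> prob_measures_on I" by (simp add: prob_measures_on_def M_def)
  have "{x \<in> space ?N. x \<in> {a, b}} = I \<inter> {a, b}" by (auto simp: space_restrict_space)
  then have "{x \<in> space ?N. x \<in> {a, b}} \<in> sets ?N"
    by (simp add: sets_restrict_space)
  then have "AE y in M. y \<in> {a, b}"
    unfolding M_def by (subst AE_distr_iff[OF g]) simp_all
  with Mp I have 1: "M \<in> compactly_supported_measures I"
    unfolding compactly_supported_measures_def by (auto intro!: exI[of _ "{a, b}"])
  have 2: "expected_score S M x = ennreal p * ennreal (S x a) + ennreal (1 - p) * ennreal (S x b)"
    if "S x \<in> borel_measurable ?N" for S x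
    using that p unfolding expected_score_def M_def
    by (subst nn_integral_distr[OF g]) (auto simp: mult.commute)
  have 3: "(LINT y|M. f y) = p * f a + (1 - p) * f b"
    if "f \<in> borel_measurable borel" for f :: "real \<Rightarrow> real"
    using that p unfolding M_def
    by (subst integral_distr[OF g]) (auto simp: measurable_restrict_space1)
  show thesis using that 1 2 3 by blast
qed

text \<open>The masses \<open>p\<close> at \<open>a\<close> and \<open>1 - p\<close> at \<open>b\<close> are chosen proportional to \<open>\<tau> (b - x)\<close> and
  \<open>(1 - \<tau>) (x - a)\<close>, which makes \<open>x\<close> the expectile. Consistency says that \<open>x\<close> minimises the expected
  score over \<open>I\<close>, and \<open>x\<close> is an interior point, so the derivative vanishes there.\<close>

lemma consistent_first_order_condition:
  assumes \<tau>: "0 < \<tau>" "\<tau> < 1" and I: "is_interval I" and sf: "scoring_function I S"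
    and cons: "consistent I (compactly_supported_measures I) (expectile \<tau>) S"
    and ab: "a \<in> I" "b \<in> I" "a < x" "x < b"
    and da: "((\<lambda>x. S x a) has_real_derivative da) (at x)"
    and db: "((\<lambda>x. S x b) has_real_derivative db) (at x)"
  shows "\<tau> * (b - x) * da + (1 - \<tau>) * (x - a) * db = 0"
proof -
  define D where "D = \<tau> * (b - x) + (1 - \<tau>) * (x - a)"
  have parts: "0 < \<tau> * (b - x)" "0 < (1 - \<tau>) * (x - a)" using \<tau> ab by auto
  then have D: "0 < D" by (simp add: D_def)
  define p where "p = \<tau> * (b - x) / D"
  have p1: "1 - p = (1 - \<tau>) * (x - a) / D"
    using D by (simp add: p_def diff_divide_eq_iff D_def)
  have p: "0 \<le> p" "p \<le> 1"
    using parts D p1 by (auto simp: p_def D_def)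
  obtain M where M: "M \<in> compactly_supported_measures I"
    and E: "\<And>S x. S x \<in> borel_measurable (restrict_space borel I) \<Longrightarrow>
           expected_score S M x = ennreal p * ennreal (S x a) + ennreal (1 - p) * ennreal (S x b)"
    and L: "\<And>f. f \<in> borel_measurable borel \<Longrightarrow> (LINT y|M. f y :: real) = p * f a + (1 - p) * f b"
    using two_point_measure[OF p ab(1,2)] by blast
  have "expectile_identification \<tau> x \<in> borel_measurable borel"
    unfolding expectile_identification_def using asym_weight_measurable by measurable
  then have "(LINT y|M. expectile_identification \<tau> x y)
      = p * ((1 - \<tau>) * (a - x)) + (1 - p) * (\<tau> * (b - x))"
    using ab \<tau> by (subst L) (auto simp: expectile_identification_def asym_weight_eq)
  also have "\<dots> = 0" unfolding p1 unfolding p_def using D by (simp add: field_simps)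
  finally have t: "expectile \<tau> M = x"
    using expectile_eq_iff[OF \<tau> compactly_supported_finite_mean[OF M]] by blast
  define f where "f z = p * S z a + (1 - p) * S z b" for z
  have Ef: "expected_score S M z = ennreal (f z)" and f0: "0 \<le> f z" if "z \<in> I" for z
  proof -
    have s: "0 \<le> S z a" "0 \<le> S z b" using sf that ab by (auto simp: scoring_function_def)
    show "expected_score S M z = ennreal (f z)"
      using sf that s p by (subst E) (auto simp: scoring_function_def f_def ennreal_mult ennreal_plus)
    show "0 \<le> f z" using s p by (simp add: f_def)
  qed
  have inI: "z \<in> I" if "a \<le> z" "z \<le> b" for z using I ab that unfolding is_interval_1 by blast
  have min: "f x \<le> f z" if "z \<in> I" for z
  proof -
    have "expected_score S M x \<le> expected_score S M z"
      using cons M t that unfolding consistent_def by blast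
    then show ?thesis using Ef f0 that inI[of x] ab by simp
  qed
  have "(f has_real_derivative p * da + (1 - p) * db) (at x)"
    unfolding f_def by (intro DERIV_add DERIV_cmult da db)
  then have "p * da + (1 - p) * db = 0"
  proof (rule DERIV_local_min)
    show "0 < min (x - a) (b - x)" using ab by simp
    show "\<forall>y. \<bar>x - y\<bar> < min (x - a) (b - x) \<longrightarrow> f x \<le> f y"
      using inI by (auto intro!: min)
  qed
  then have "D * (p * da + (1 - p) * db) = 0" by simp
  moreover have "D * p = \<tau> * (b - x)" using D by (simp add: p_def)
  moreover have "D * (1 - p) = (1 - \<tau>) * (x - a)" using D by (simp add: p1)
  ultimately show ?thesis by (simp only: distrib_left mult.assoc[symmetric])
qed

text \<open>Off the diagonal the weight is locally constant in its first argument.\<close>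

lemma weighted_score_derivative:
  assumes \<tau>: "0 < \<tau>" "\<tau> < 1" and "x \<noteq> y"
    and d: "((\<lambda>x. S x y) has_real_derivative d) (at x)"
  shows "((\<lambda>x. S x y / asym_weight \<tau> x y) has_real_derivative d / asym_weight \<tau> x y) (at x)"
proof -
  define U where "U = (if x < y then {..<y} else {y<..})"
  have "((\<lambda>z. S z y / asym_weight \<tau> x y) has_real_derivative d / asym_weight \<tau> x y) (at x)"
    by (rule DERIV_cdivide[OF d])
  then show ?thesis
  proof (rule has_field_derivative_transform_within_open)
    show "open U" "x \<in> U" using assms(3) by (auto simp: U_def)
    show "S z y / asym_weight \<tau> x y = S z y / asym_weight \<tau> z y" if "z \<in> U" for z
      using that assms(3) \<tau> by (auto simp: U_def asym_weight_eq split: if_splits)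
  qed
qed

text \<open>The first-order condition equates the quotient \<open>d y / w(x, y) / (x - y)\<close> for one
  observation below \<open>x\<close> with the same quotient for one above. Comparing every observation with a
  fixed one on the other side shows that the quotient is the same for all of them.\<close>

lemma consistent_osband:
  assumes \<tau>: "0 < \<tau>" "\<tau> < 1" and I: "is_interval I" and sf: "scoring_function I S"
    and S2: "score_S2 I S"
    and cons: "consistent I (compactly_supported_measures I) (expectile \<tau>) S"
    and x: "x \<in> interior I"
  shows "\<exists>h. \<forall>y\<in>I - {x}.
    ((\<lambda>x. S x y / asym_weight \<tau> x y) has_real_derivative (x - y) * h) (at x)"
proof -
  have xI: "x \<in> I" using x interior_subset by blast
  have "\<exists>d. ((\<lambda>x. S x y) has_real_derivative d) (at x)" if "y \<in> I - {x}" for y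
    using S2 that xI at_within_interior[OF x] unfolding score_S2_def by (metis Diff_iff singletonD)
  then obtain d where d: "\<And>y. y \<in> I - {x} \<Longrightarrow> ((\<lambda>x. S x y) has_real_derivative d y) (at x)"
    by metis
  obtain e where e: "0 < e" "cball x e \<subseteq> I" using x mem_interior_cball by blast
  define a b where "a = x - e" and "b = x + e"
  have ab: "a \<in> I" "b \<in> I" "a < x" "x < b"
    using e by (auto simp: a_def b_def dist_real_def subset_iff)
  note foc = consistent_first_order_condition[OF \<tau> I sf cons]
  define h where "h = d b / \<tau> / (x - b)"
  have rel: "d y = asym_weight \<tau> x y * ((x - y) * h)" if y: "y \<in> I - {x}" for y
  proof -
    have r: "d u / (1 - \<tau>) / (x - u) = d v / \<tau> / (x - v)"
      if "u \<in> I" "v \<in> I" "u < x" "x < v" for u v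
    proof -
      have "\<tau> * (v - x) * d u + (1 - \<tau>) * (x - u) * d v = 0"
        using foc[OF that] d that by auto
      then have "d u * (\<tau> * (x - v)) = d v * ((1 - \<tau>) * (x - u))" by (simp add: algebra_simps)
      moreover have "(1 - \<tau>) * (x - u) \<noteq> 0" "\<tau> * (x - v) \<noteq> 0" using \<tau> that by auto
      ultimately show ?thesis
        unfolding divide_divide_eq_left by (subst frac_eq_eq)
    qed
    have "d y / asym_weight \<tau> x y / (x - y) = h"
    proof (cases "y < x")
      case True
      then show ?thesis using r[of y b] y ab \<tau> by (simp add: h_def asym_weight_eq)
    next
      case False
      then show ?thesis using r[of a y] r[of a b] y ab \<tau> by (simp add: h_def asym_weight_eq)
    qed
    then show ?thesis
      using y asym_weight_pos[OF \<tau>, of x y] by (auto simp: field_simps)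
  qed
  show ?thesis
  proof (intro exI[of _ h] ballI)
    fix y assume y: "y \<in> I - {x}"
    have "d y / asym_weight \<tau> x y = (x - y) * h"
      using rel[OF y] asym_weight_pos[OF \<tau>, of x y] by simp
    then show "((\<lambda>x. S x y / asym_weight \<tau> x y) has_real_derivative (x - y) * h) (at x)"
      using weighted_score_derivative[where S = S, OF \<tau> _ d[OF y]] y by auto
  qed
qed

text \<open>The weight jumps at \<open>x = y\<close>, but the score vanishes there.\<close>

lemma continuous_on_weighted_score:
  assumes \<tau>: "0 < \<tau>" "\<tau> < 1" and y: "y \<in> I"
    and S0: "score_S0 I S" and S1: "score_S1 I S"
  shows "continuous_on I (\<lambda>x. S x y / asym_weight \<tau> x y)"
proof -
  have c: "continuous_on I (\<lambda>x. S x y)" using S1 y by (simp add: score_S1_def)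
  \<comment> \<open>Of the two summands one is always zero, because \<open>S y y = 0\<close>.\<close>
  have "continuous_on I (\<lambda>x. S (max x y) y / (1 - \<tau>) + S (min x y) y / \<tau>)"
    using \<tau> y by (intro continuous_intros continuous_on_compose2[OF c]) (auto simp: max_def min_def)
  moreover have "S y y = 0" using S0 y by (simp add: score_S0_def)
  then have "S (max x y) y / (1 - \<tau>) + S (min x y) y / \<tau> = S x y / asym_weight \<tau> x y" for x
    using \<tau> by (auto simp: max_def min_def asym_weight_eq)
  ultimately show ?thesis by simp
qed

lemma interval_constant_if_derivative_zero:
  fixes F :: "real \<Rightarrow> real"
  assumes I: "is_interval I" and cont: "continuous_on I F" and fin: "finite K"
    and der: "\<And>x. x \<in> interior I - K \<Longrightarrow> (F has_real_derivative 0) (at x)"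
    and xy: "x \<in> I" "y \<in> I"
  shows "F x = F y"
proof -
  have *: "F b = F a" if "a \<in> I" "b \<in> I" "a \<le> b" for a b
  proof -
    have sub: "{a..b} \<subseteq> I" using mem_is_interval_1_I[OF I that(1,2)] by auto
    show ?thesis
    proof (rule has_derivative_zero_unique_strong_interval[of "insert a (insert b K)" a b F "F a"])
      show "continuous_on {a..b} F" using continuous_on_subset[OF cont sub] .
      fix z assume z: "z \<in> {a..b} - insert a (insert b K)"
      then have "z \<in> interior I"
        using sub by (intro interiorI[of "{a<..<b}"]) auto
      with der z show "(F has_derivative (\<lambda>h. 0)) (at z within {a..b})"
        by (auto simp: has_field_derivative_def lambda_zero intro: has_derivative_at_withinI)
    qed (use fin that in auto)
  qed
  show ?thesis using *[of x y] *[of y x] xy by (cases "x \<le> y") auto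
qed

text \<open>The representation is obtained without recovering \<open>h\<close>. For fixed \<open>x\<close> and \<open>y\<close> the combination
  \<open>F s = (B s y - B s x) (z\<^sub>0 - y\<^sub>0) - (B s y\<^sub>0 - B s z\<^sub>0) (x - y)\<close> has derivative zero outside finitely
  many points, since all its parts have derivatives proportional to \<open>h s\<close>. As it is continuous, it is
  constant on \<open>I\<close>, endpoints included, and \<open>F x = F y\<^sub>0\<close> is the required formula because \<open>B x x = 0\<close>.\<close>

lemma consistent_imp_expectile_score:
  assumes \<tau>: "0 < \<tau>" "\<tau> < 1" and I: "is_interval I" and sf: "scoring_function I S"
    and S0: "score_S0 I S" and S1: "score_S1 I S" and S2: "score_S2 I S"
    and cons: "consistent I (compactly_supported_measures I) (expectile \<tau>) S"
  shows "\<exists>\<phi> \<phi>'. convex_on I \<phi> \<and> subgradient_on I \<phi> \<phi>' \<and>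
    (\<forall>x\<in>I. \<forall>y\<in>I. S x y = expectile_score \<tau> \<phi> \<phi>' x y)"
proof -
  define B where "B x y = S x y / asym_weight \<tau> x y" for x y
  have w: "0 < asym_weight \<tau> x y" for x y by (rule asym_weight_pos[OF \<tau>])
  have B0: "B x x = 0" and Bpos: "0 \<le> B x y" if "x \<in> I" "y \<in> I" for x y
    using S0 that w[of x y] by (auto simp: B_def score_S0_def)
  have "\<exists>\<phi> \<phi>'. \<forall>x\<in>I. \<forall>y\<in>I. B x y = bregman \<phi> \<phi>' x y"
  proof (cases "\<exists>y\<in>I. \<exists>z\<in>I. y \<noteq> z")
    case False
    \<comment> \<open>Here \<open>I\<close> has at most one point, so only \<open>S x x = 0\<close> has to be represented.\<close>
    then show ?thesis using B0 by (intro exI[of _ "\<lambda>_. 0"]) (auto simp: bregman_def)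
  next
    case True
    then obtain y\<^sub>0 z\<^sub>0 where yz0: "y\<^sub>0 \<in> I" "z\<^sub>0 \<in> I" "y\<^sub>0 \<noteq> z\<^sub>0" by blast
    define E where "E x = B x y\<^sub>0 - B x z\<^sub>0" for x
    define \<phi> where "\<phi> = B y\<^sub>0"
    define \<phi>' where "\<phi>' x = (E x - E y\<^sub>0) / (z\<^sub>0 - y\<^sub>0)" for x
    have "B x y = bregman \<phi> \<phi>' x y" if x: "x \<in> I" and y: "y \<in> I" for x y
    proof -
      define F where "F s = (B s y - B s x) * (z\<^sub>0 - y\<^sub>0) - E s * (x - y)" for s
      have "F x = F y\<^sub>0"
      proof (rule interval_constant_if_derivative_zero[OF I, of F "{x, y, y\<^sub>0, z\<^sub>0}"])
        show "continuous_on I F"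
          unfolding F_def E_def B_def using x y yz0
          by (intro continuous_on_diff continuous_on_mult continuous_on_const
              continuous_on_weighted_score[OF \<tau> _ S0 S1])
        fix s assume s: "s \<in> interior I - {x, y, y\<^sub>0, z\<^sub>0}"
        then obtain h where h: "\<And>u. u \<in> I - {s} \<Longrightarrow>
            ((\<lambda>s. B s u) has_real_derivative (s - u) * h) (at s)"
          using consistent_osband[OF \<tau> I sf S2 cons, of s] unfolding B_def by blast
        have "(F has_real_derivative
            ((s - y) * h - (s - x) * h) * (z\<^sub>0 - y\<^sub>0) - ((s - y\<^sub>0) * h - (s - z\<^sub>0) * h) * (x - y)) (at s)"
          unfolding F_def E_def using s x y yz0
          by (intro DERIV_diff DERIV_cmult_right h) auto
        then show "(F has_real_derivative 0) (at s)" by (simp add: algebra_simps)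
      qed (use x yz0 in auto)
      then have "B x y * (z\<^sub>0 - y\<^sub>0) = (\<phi> y - \<phi> x) * (z\<^sub>0 - y\<^sub>0) - (E x - E y\<^sub>0) * (y - x)"
        using B0[OF x x] by (simp add: F_def \<phi>_def algebra_simps)
      also have "\<dots> = bregman \<phi> \<phi>' x y * (z\<^sub>0 - y\<^sub>0)"
        using yz0 by (simp add: bregman_def \<phi>'_def field_simps)
      finally show ?thesis using yz0 by simp
    qed
    then show ?thesis by blast
  qed
  then obtain \<phi> \<phi>' where rep: "\<And>x y. x \<in> I \<Longrightarrow> y \<in> I \<Longrightarrow> B x y = bregman \<phi> \<phi>' x y" by blast
  have sub: "subgradient_on I \<phi> \<phi>'"
    using rep Bpos by (fastforce simp: subgradient_on_def bregman_def)
  moreover have "convex_on I \<phi>"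
    using convex_on_if_subgradient_on[OF _ sub] I by (simp add: is_interval_convex_1)
  moreover have "S x y = expectile_score \<tau> \<phi> \<phi>' x y" if "x \<in> I" "y \<in> I" for x y
    using rep[OF that] w[of x y] by (simp add: expectile_score_eq B_def field_simps)
  ultimately show ?thesis by blast
qed

section \<open>Elicitability\<close>

lemma strictly_convex_on_if_bregman_pos:
  assumes "convex I" and pos: "\<And>x y. x \<noteq> y \<Longrightarrow> 0 < bregman \<phi> \<phi>' x y"
  shows "strictly_convex_on I \<phi>"
  unfolding strictly_convex_on_def
proof (intro conjI ballI allI impI)
  fix x y u v :: real
  assume uv: "0 < u" "0 < v" "u + v = 1" and "x \<noteq> y"
  define z where "z = u * x + v * y"
  have v: "v = 1 - u" using uv by simp
  have "x - z = v * (x - y)" "y - z = u * (y - x)" by (simp_all add: z_def v algebra_simps)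
  then have "z \<noteq> x" "z \<noteq> y" using uv \<open>x \<noteq> y\<close> by auto
  then have "0 < u * bregman \<phi> \<phi>' z x + v * bregman \<phi> \<phi>' z y"
    using uv pos by (intro add_pos_pos mult_pos_pos) auto
  also have "\<dots> = u * \<phi> x + v * \<phi> y - \<phi> z" by (simp add: bregman_def z_def v algebra_simps)
  finally show "\<phi> (u * x + v * y) < u * \<phi> x + v * \<phi> y" by (simp add: z_def)
qed (rule assms(1))

text \<open>After multiplication by \<open>sqrt (1 + x\<^sup>2)\<close> this is the strict Cauchy--Schwarz inequality for
  the vectors \<open>(1, x)\<close> and \<open>(1, y)\<close>.\<close>

lemma bregman_sqrt_pos:
  fixes x y :: real
  assumes "x \<noteq> y"
  shows "0 < bregman (\<lambda>y. sqrt (1 + y\<^sup>2)) (\<lambda>x. x / sqrt (1 + x\<^sup>2)) x y"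
proof -
  define r where "r = sqrt (1 + x\<^sup>2)"
  have r: "0 < r" "r * r = 1 + x * x"
    by (simp_all add: r_def add_pos_nonneg power2_eq_square[symmetric])
  have "(1 + x * y)\<^sup>2 < (1 + x\<^sup>2) * (1 + y\<^sup>2)"
  proof -
    have "(1 + x\<^sup>2) * (1 + y\<^sup>2) - (1 + x * y)\<^sup>2 = (x - y)\<^sup>2"
      by (simp add: power2_eq_square algebra_simps)
    moreover have "0 < (x - y)\<^sup>2" using assms by simp
    ultimately show ?thesis by linarith
  qed
  then have "1 + x * y < sqrt ((1 + x\<^sup>2) * (1 + y\<^sup>2))" by (rule real_less_rsqrt)
  then have "1 + x * y < r * sqrt (1 + y\<^sup>2)" by (simp add: r_def real_sqrt_mult)
  moreover have "r * bregman (\<lambda>y. sqrt (1 + y\<^sup>2)) (\<lambda>x. x / sqrt (1 + x\<^sup>2)) x y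
      = r * sqrt (1 + y\<^sup>2) - (1 + x * y)"
    using r unfolding bregman_def r_def[symmetric] by (simp add: field_simps)
  ultimately have "0 < r * bregman (\<lambda>y. sqrt (1 + y\<^sup>2)) (\<lambda>x. x / sqrt (1 + x\<^sup>2)) x y"
    by linarith
  then show ?thesis using r(1) by (simp add: zero_less_mult_iff)
qed

text \<open>Because \<open>sqrt (1 + y\<^sup>2) \<le> 1 + \<bar>y\<bar>\<close>, integrability of this \<open>\<phi>\<close> follows from that of the
  identity.\<close>

lemma elicitable_expectile:
  assumes \<tau>: "0 < \<tau>" "\<tau> < 1" and I: "is_interval I"
  shows "elicitable I (finite_mean_measures I) (expectile \<tau>)"
proof -
  let ?\<phi> = "\<lambda>y :: real. sqrt (1 + y\<^sup>2)" and ?\<phi>' = "\<lambda>x :: real. x / sqrt (1 + x\<^sup>2)"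
  have conv: "strictly_convex_on I ?\<phi>"
    using strictly_convex_on_if_bregman_pos[OF _ bregman_sqrt_pos] I
    by (simp add: is_interval_convex_1)
  have "0 \<le> bregman ?\<phi> ?\<phi>' x y" for x y
    using bregman_sqrt_pos[of x y] by (cases "x = y") (auto simp: bregman_def)
  then have sub: "subgradient_on I ?\<phi> ?\<phi>'"
    by (auto simp: subgradient_on_def bregman_def algebra_simps)
  have "integrable M ?\<phi>" if M: "M \<in> finite_mean_measures I" for M
  proof -
    have Mp: "M \<in> prob_measures_on I" and int: "integrable M (\<lambda>y. y)"
      using M by (auto simp: finite_mean_measures_def)
    interpret prob_space M by (rule prob_measures_onD(1)[OF Mp])
    have "integrable M (\<lambda>y. 1 + \<bar>y\<bar>)" using int by simp
    then show ?thesis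
    proof (rule Bochner_Integration.integrable_bound)
      show "?\<phi> \<in> borel_measurable M"
        by (intro borel_measurable_prob_measures_on[OF Mp] measurable_restrict_space1) measurable
      show "AE y in M. norm (?\<phi> y) \<le> norm (1 + \<bar>y\<bar>)"
      proof (rule AE_I2)
        fix y :: real
        show "norm (?\<phi> y) \<le> norm (1 + \<bar>y\<bar>)"
          using sqrt_add_le_add_sqrt[of 1 "y\<^sup>2"] by simp
      qed
    qed
  qed
  then have "finite_mean_measures I = {M \<in> prob_measures_on I. integrable M (\<lambda>y. y) \<and> integrable M ?\<phi>}"
    by (auto simp: finite_mean_measures_def)
  then have "strictly_consistent I (finite_mean_measures I) (expectile \<tau>) (expectile_score \<tau> ?\<phi> ?\<phi>')"
    using strictly_consistent_expectile_score[OF \<tau> I conv sub] by simp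
  then show ?thesis
    using scoring_function_expectile_score[OF strictly_convex_imp_convex_on[OF conv] sub]
    unfolding elicitable_def by (intro exI[of _ "expectile_score \<tau> ?\<phi> ?\<phi>'"] conjI)
qed

theorem theorem3p4:
  fixes I :: "real set" and \<tau> :: real
  assumes "is_interval I" and "0 < \<tau>" and "\<tau> < 1"
  shows "elicitable I (finite_mean_measures I) (expectile \<tau>) \<and>
    (\<forall>S. scoring_function I S \<and> score_S0 I S \<and> score_S1 I S \<and> score_S2 I S \<longrightarrow>
       (consistent I (compactly_supported_measures I) (expectile \<tau>) S \<longleftrightarrow>
        (\<exists>\<phi> \<phi>'. convex_on I \<phi> \<and> subgradient_on I \<phi> \<phi>' \<and>
           (\<forall>x\<in>I. \<forall>y\<in>I. S x y = expectile_score \<tau> \<phi> \<phi>' x y)))) \<and>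
    (\<forall>\<phi> \<phi>'. strictly_convex_on I \<phi> \<and> subgradient_on I \<phi> \<phi>' \<longrightarrow>
       scoring_function I (expectile_score \<tau> \<phi> \<phi>') \<and>
       strictly_consistent I
         {M \<in> prob_measures_on I. integrable M (\<lambda>y. y) \<and> integrable M \<phi>}
         (expectile \<tau>) (expectile_score \<tau> \<phi> \<phi>'))"
proof (intro conjI allI impI)
  note \<tau> = assms(2,3) and I = assms(1)
  show "elicitable I (finite_mean_measures I) (expectile \<tau>)"
    by (rule elicitable_expectile[OF \<tau> I])
  show "consistent I (compactly_supported_measures I) (expectile \<tau>) S \<longleftrightarrow>
      (\<exists>\<phi> \<phi>'. convex_on I \<phi> \<and> subgradient_on I \<phi> \<phi>' \<and>
        (\<forall>x\<in>I. \<forall>y\<in>I. S x y = expectile_score \<tau> \<phi> \<phi>' x y))"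
    if "scoring_function I S \<and> score_S0 I S \<and> score_S1 I S \<and> score_S2 I S" for S
  proof
    assume "consistent I (compactly_supported_measures I) (expectile \<tau>) S"
    with that show "\<exists>\<phi> \<phi>'. convex_on I \<phi> \<and> subgradient_on I \<phi> \<phi>' \<and>
        (\<forall>x\<in>I. \<forall>y\<in>I. S x y = expectile_score \<tau> \<phi> \<phi>' x y)"
      by (intro consistent_imp_expectile_score[OF \<tau> I]) simp_all
  next
    assume "\<exists>\<phi> \<phi>'. convex_on I \<phi> \<and> subgradient_on I \<phi> \<phi>' \<and>
        (\<forall>x\<in>I. \<forall>y\<in>I. S x y = expectile_score \<tau> \<phi> \<phi>' x y)"
    then obtain \<phi> \<phi>' where "convex_on I \<phi>" "subgradient_on I \<phi> \<phi>'"
      and "\<And>x y. x \<in> I \<Longrightarrow> y \<in> I \<Longrightarrow> S x y = expectile_score \<tau> \<phi> \<phi>' x y"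
      by auto
    then show "consistent I (compactly_supported_measures I) (expectile \<tau>) S"
      by (rule consistent_expectile_score[OF \<tau> I])
  qed
  fix \<phi> \<phi>' assume "strictly_convex_on I \<phi> \<and> subgradient_on I \<phi> \<phi>'"
  then have conv: "strictly_convex_on I \<phi>" and sub: "subgradient_on I \<phi> \<phi>'" by simp_all
  show "scoring_function I (expectile_score \<tau> \<phi> \<phi>')"
    by (rule scoring_function_expectile_score[OF strictly_convex_imp_convex_on[OF conv] sub])
  show "strictly_consistent I
      {M \<in> prob_measures_on I. integrable M (\<lambda>y. y) \<and> integrable M \<phi>}
      (expectile \<tau>) (expectile_score \<tau> \<phi> \<phi>')"
    by (rule strictly_consistent_expectile_score[OF \<tau> I conv sub])
qed

end
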